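(* Let $G$ be a group of order $2^m$ of rank $3$. Then (1) $\displaystyle A_G(t/|G|)=\frac{1-2^{-2}}{1-2^{-1}t} + \frac{2^{-2}}{1-t}$; (2) $\displaystyle B_G(t/|G|)=\frac{-2^{-1}}{1-2^{-2}t} + \frac{1+2^{-1}}{1-2^{-1}t}$.
   Context: For a finite group $G$ and $n\ge 0$, $\alpha_{G,n}$ denotes the number of orbits of $G$ acting on $G^n$ by simultaneous conjugation $g\cdot(x_1,\dots,x_n)=(gx_1g^{-1},\dots,gx_ng^{-1})$, and $\beta_{G,n}$ denotes the number of orbits of the same action on the set $G^{(n)}$ of $n$-tuples of pairwise commuting elements of $G$; $\alpha_{G,0}=\beta_{G,0}=1$. Set $A_G(t)=\sum_{n\ge 0}\alpha_{G,n}t^n$ and $B_G(t)=\sum_{n\ge 0}\beta_{G,n}t^n$ (formal power series, which are rational functions of $t$). $A_G(t/|G|)$, $B_G(t/|G|)$ denote the result of substituting $t/|G|$ for $t$. Finite groups $G,H$ are isoclinic if there are isomorphisms $\theta:G/Z(G)\to H/Z(H)$ and $\phi:G'\to H'$ (derived subgroups) such that $\phi([g_1,g_2])=[h_1,h_2]$ whenever $\theta(g_iZ(G))=h_iZ(H)$ for $i=1,2$. Isoclinism is an equivalence relation, whose classes are called isoclinism families. For a finite $2$-group $G$, the rank of (the family of) $G$ is the smallest $r$ such that the isoclinism family of $G$ contains a group of order $2^r$; equivalently $2^r=|G/Z(G)|\,|Z(G)\cap G'|$. *)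

theory Defs
  imports
    "HOL-Algebra.Algebra"
    "HOL-Computational_Algebra.Formal_Power_Series"
begin

section \<open>Orbits of simultaneous conjugation\<close>

definition tuples :: "('a, 'b) monoid_scheme \<Rightarrow> nat \<Rightarrow> 'a list set" where
  "tuples G n = {xs. length xs = n \<and> set xs \<subseteq> carrier G}"

definition commuting_tuples :: "('a, 'b) monoid_scheme \<Rightarrow> nat \<Rightarrow> 'a list set" where
  "commuting_tuples G n =
     {xs \<in> tuples G n. \<forall>x\<in>set xs. \<forall>y\<in>set xs. x \<otimes>\<^bsub>G\<^esub> y = y \<otimes>\<^bsub>G\<^esub> x}"

text \<open>The restriction to \<open>E\<close> is what \<^locale>\<open>group_action\<close> requires of an action on \<open>E\<close>.\<close>

definition conj_action ::
    "('a, 'b) monoid_scheme \<Rightarrow> 'a list set \<Rightarrow> 'a \<Rightarrow> 'a list \<Rightarrow> 'a list" where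
  "conj_action G E g = (\<lambda>xs\<in>E. map (\<lambda>x. g \<otimes>\<^bsub>G\<^esub> x \<otimes>\<^bsub>G\<^esub> inv\<^bsub>G\<^esub> g) xs)"

definition alpha :: "('a, 'b) monoid_scheme \<Rightarrow> nat \<Rightarrow> nat" where
  "alpha G n = card (orbits G (tuples G n) (conj_action G (tuples G n)))"

definition beta :: "('a, 'b) monoid_scheme \<Rightarrow> nat \<Rightarrow> nat" where
  "beta G n = card (orbits G (commuting_tuples G n) (conj_action G (commuting_tuples G n)))"

definition A_series :: "('a, 'b) monoid_scheme \<Rightarrow> rat fps" where
  "A_series G = Abs_fps (\<lambda>n. of_nat (alpha G n))"

definition B_series :: "('a, 'b) monoid_scheme \<Rightarrow> rat fps" where
  "B_series G = Abs_fps (\<lambda>n. of_nat (beta G n))"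

context group
begin

lemma conj_action_group_action:
  assumes E: "E \<subseteq> lists (carrier G)"
    and closed: "\<And>g xs. g \<in> carrier G \<Longrightarrow> xs \<in> E \<Longrightarrow> map (\<lambda>x. g \<otimes> x \<otimes> inv g) xs \<in> E"
  shows "group_action G E (conj_action G E)"
proof -
  have comp: "map (\<lambda>x. g \<otimes> x \<otimes> inv g) (map (\<lambda>x. h \<otimes> x \<otimes> inv h) xs)
      = map (\<lambda>x. g \<otimes> h \<otimes> x \<otimes> inv (g \<otimes> h)) xs"
    if "g \<in> carrier G" "h \<in> carrier G" "xs \<in> E" for g h xs
    using that E by (auto simp: m_assoc inv_mult_group in_lists_conv_set)
  have ident: "map (\<lambda>x. \<one> \<otimes> x \<otimes> inv \<one>) xs = xs" if "xs \<in> E" for xs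
    using that E by (auto simp: in_lists_conv_set intro!: map_idI)
  have bij: "conj_action G E g \<in> Bij E" if g: "g \<in> carrier G" for g
  proof -
    have "bij_betw (conj_action G E g) E E"
    proof (rule bij_betw_byWitness[where f' = "conj_action G E (inv g)"])
      show "\<forall>a\<in>E. conj_action G E (inv g) (conj_action G E g a) = a"
        using comp[of "inv g" g] ident closed g unfolding conj_action_def by (simp del: map_map)
      show "\<forall>a\<in>E. conj_action G E g (conj_action G E (inv g) a) = a"
        using comp[of g "inv g"] ident closed[of "inv g"] g unfolding conj_action_def
        by (simp del: map_map)
    qed (use closed[OF g] closed[of "inv g"] g in \<open>auto simp: conj_action_def\<close>)
    then show ?thesis by (simp add: Bij_def conj_action_def)
  qed
  have "conj_action G E \<in> hom G (BijGroup E)"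
  proof (rule homI)
    fix g h assume gh: "g \<in> carrier G" "h \<in> carrier G"
    show "conj_action G E (g \<otimes> h) =
        conj_action G E g \<otimes>\<^bsub>BijGroup E\<^esub> conj_action G E h"
      using gh bij comp closed
      by (auto simp: BijGroup_def compose_def conj_action_def fun_eq_iff simp del: map_map)
  qed (simp add: BijGroup_def bij)
  then show ?thesis
    by (simp add: group_action_def group_hom_def group_hom_axioms_def group_BijGroup is_group)
qed

lemma conj_action_tuples: "group_action G (tuples G n) (conj_action G (tuples G n))"
  by (rule conj_action_group_action) (auto simp: tuples_def)

lemma conj_action_commuting_tuples:
  "group_action G (commuting_tuples G n) (conj_action G (commuting_tuples G n))"
proof (rule conj_action_group_action)
  fix g xs assume g: "g \<in> carrier G" and xs: "xs \<in> commuting_tuples G n"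
  have prod: "(g \<otimes> x \<otimes> inv g) \<otimes> (g \<otimes> y \<otimes> inv g) = g \<otimes> (x \<otimes> y) \<otimes> inv g"
    if "x \<in> carrier G" "y \<in> carrier G" for x y
    using that g by (metis inv_closed inv_solve_right m_assoc m_closed)
  show "map (\<lambda>x. g \<otimes> x \<otimes> inv g) xs \<in> commuting_tuples G n"
    using g xs by (auto simp: commuting_tuples_def tuples_def prod subset_iff)
qed (auto simp: commuting_tuples_def tuples_def)

end


section \<open>Isoclinism\<close>

definition center :: "('a, 'b) monoid_scheme \<Rightarrow> 'a set" where
  "center G = {z \<in> carrier G. \<forall>x\<in>carrier G. z \<otimes>\<^bsub>G\<^esub> x = x \<otimes>\<^bsub>G\<^esub> z}"

text \<open>The same convention as in \<^const>\<open>derived\<close>.\<close>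

definition commutator :: "('a, 'b) monoid_scheme \<Rightarrow> 'a \<Rightarrow> 'a \<Rightarrow> 'a" where
  "commutator G x y = x \<otimes>\<^bsub>G\<^esub> y \<otimes>\<^bsub>G\<^esub> inv\<^bsub>G\<^esub> x \<otimes>\<^bsub>G\<^esub> inv\<^bsub>G\<^esub> y"

definition isoclinic :: "('a, 'b) monoid_scheme \<Rightarrow> ('c, 'd) monoid_scheme \<Rightarrow> bool" where
  "isoclinic G H \<longleftrightarrow>
     (\<exists>\<theta> \<phi>. \<theta> \<in> iso (G Mod center G) (H Mod center H)
        \<and> \<phi> \<in> iso (G\<lparr>carrier := derived G (carrier G)\<rparr>) (H\<lparr>carrier := derived H (carrier H)\<rparr>)
        \<and> (\<forall>g\<^sub>1\<in>carrier G. \<forall>g\<^sub>2\<in>carrier G. \<forall>h\<^sub>1\<in>carrier H. \<forall>h\<^sub>2\<in>carrier H.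
              \<theta> (center G #>\<^bsub>G\<^esub> g\<^sub>1) = center H #>\<^bsub>H\<^esub> h\<^sub>1 \<and>
              \<theta> (center G #>\<^bsub>G\<^esub> g\<^sub>2) = center H #>\<^bsub>H\<^esub> h\<^sub>2 \<longrightarrow>
              \<phi> (commutator G g\<^sub>1 g\<^sub>2) = commutator H h\<^sub>1 h\<^sub>2))"

text \<open>
  The rank is meant for finite 2-groups. Every finite group has an isomorphic copy on natural
  numbers, so letting \<open>H\<close> range over groups with elements of type \<^typ>\<open>nat\<close> loses nothing; see
  \<open>isoclinism_rank_le\<close> and \<open>isoclinism_rank_attained\<close> below.
\<close>

definition isoclinism_rank :: "('a, 'b) monoid_scheme \<Rightarrow> nat" where
  "isoclinism_rank G =
     (LEAST r. \<exists>H :: nat monoid. group H \<and> order H = 2 ^ r \<and> isoclinic G H)"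

lemma center_subset: "center G \<subseteq> carrier G"
  by (auto simp: center_def)

lemma center_closed: "z \<in> center G \<Longrightarrow> z \<in> carrier G"
  by (simp add: center_def)

lemma center_comm: "z \<in> center G \<Longrightarrow> x \<in> carrier G \<Longrightarrow> z \<otimes>\<^bsub>G\<^esub> x = x \<otimes>\<^bsub>G\<^esub> z"
  unfolding center_def by blast

lemma centerI:
  "z \<in> carrier G \<Longrightarrow> (\<And>x. x \<in> carrier G \<Longrightarrow> z \<otimes>\<^bsub>G\<^esub> x = x \<otimes>\<^bsub>G\<^esub> z) \<Longrightarrow> z \<in> center G"
  unfolding center_def by blast

lemma (in group) center_normal: "center G \<lhd> G"
proof (rule normalI)
  show "subgroup (center G) G"
  proof (rule subgroupI)
    show "center G \<subseteq> carrier G" by (rule center_subset)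
    have "\<one> \<in> center G" by (rule centerI) simp_all
    then show "center G \<noteq> {}" by blast
  next
    fix a assume a: "a \<in> center G"
    then have ac: "a \<in> carrier G" by (rule center_closed)
    show "inv a \<in> center G"
    proof (rule centerI)
      fix x assume x: "x \<in> carrier G"
      have "inv a \<otimes> x = inv a \<otimes> (x \<otimes> a) \<otimes> inv a"
        using ac x by (simp add: m_assoc)
      also have "\<dots> = inv a \<otimes> (a \<otimes> x) \<otimes> inv a"
        by (simp only: center_comm[OF a x])
      also have "\<dots> = x \<otimes> inv a"
        using ac x by (simp add: m_assoc[symmetric])
      finally show "inv a \<otimes> x = x \<otimes> inv a" .
    qed (use ac in simp)
  next
    fix a b assume a: "a \<in> center G" and b: "b \<in> center G"
    then have ac: "a \<in> carrier G" and bc: "b \<in> carrier G" by (simp_all add: center_closed)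
    show "a \<otimes> b \<in> center G"
    proof (rule centerI)
      fix x assume x: "x \<in> carrier G"
      have "a \<otimes> b \<otimes> x = a \<otimes> (b \<otimes> x)" using ac bc x by (simp add: m_assoc)
      also have "\<dots> = a \<otimes> (x \<otimes> b)" by (simp only: center_comm[OF b x])
      also have "\<dots> = (a \<otimes> x) \<otimes> b" using ac bc x by (simp add: m_assoc)
      also have "\<dots> = (x \<otimes> a) \<otimes> b" by (simp only: center_comm[OF a x])
      also have "\<dots> = x \<otimes> (a \<otimes> b)" using ac bc x by (simp add: m_assoc)
      finally show "a \<otimes> b \<otimes> x = x \<otimes> (a \<otimes> b)" .
    qed (use ac bc in simp)
  qed
  show "\<forall>x\<in>carrier G. center G #> x = x <# center G"
    unfolding r_coset_def l_coset_def by (simp add: center_comm)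
qed

lemma isoclinic_iso_trans:
  assumes "group H" "group K" and iso: "h \<in> iso H K" and GH: "isoclinic G H"
  shows "isoclinic G K"
proof -
  interpret H: group H by fact
  interpret K: group K by fact
  have hom: "h \<in> hom H K" and inj: "inj_on h (carrier H)" and surj: "h ` carrier H = carrier K"
    using iso by (auto simp: iso_def bij_betw_def)
  interpret h: group_hom H K h
    by unfold_locales (rule hom)
  have center: "h ` center H = center K"
  proof
    show "h ` center H \<subseteq> center K"
    proof (rule image_subsetI, rule centerI)
      fix z assume z: "z \<in> center H"
      then have zc: "z \<in> carrier H" by (rule center_closed)
      show "h z \<in> carrier K" using zc by simp
      fix w assume "w \<in> carrier K"
      then obtain v where v: "v \<in> carrier H" "w = h v" using surj by blast
      have "h (z \<otimes>\<^bsub>H\<^esub> v) = h (v \<otimes>\<^bsub>H\<^esub> z)" by (simp only: center_comm[OF z v(1)])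
      then show "h z \<otimes>\<^bsub>K\<^esub> w = w \<otimes>\<^bsub>K\<^esub> h z" using zc v by simp
    qed
    show "center K \<subseteq> h ` center H"
    proof
      fix y assume y: "y \<in> center K"
      then obtain z where z: "z \<in> carrier H" "y = h z"
        using surj center_closed[OF y] by blast
      have "z \<in> center H"
      proof (rule centerI[OF z(1)], rule inj_onD[OF inj])
        fix v assume v: "v \<in> carrier H"
        then show "h (z \<otimes>\<^bsub>H\<^esub> v) = h (v \<otimes>\<^bsub>H\<^esub> z)"
          using z center_comm[OF y h.hom_closed[OF v]] by simp
      qed (use z in auto)
      then show "y \<in> h ` center H" using z by blast
    qed
  qed
  have sub: "center H \<subseteq> carrier H" by (rule center_subset)
  have coset: "h ` (center H #>\<^bsub>H\<^esub> x) = center K #>\<^bsub>K\<^esub> h x" if "x \<in> carrier H" for x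
  proof -
    have "h (z \<otimes>\<^bsub>H\<^esub> x) = h z \<otimes>\<^bsub>K\<^esub> h x" if "z \<in> center H" for z
      using that sub \<open>x \<in> carrier H\<close> by (intro h.hom_mult) auto
    then show ?thesis unfolding center[symmetric] r_coset_def by (simp add: image_UN)
  qed
  have carr: "C \<subseteq> carrier H" if "C \<in> carrier (H Mod center H)" for C
    using that H.r_coset_subset_G[OF sub] by (auto simp: FactGroup_def RCOSETS_def)
  have \<psi>: "(`) h \<in> iso (H Mod center H) (K Mod center K)"
  proof (rule isoI)
    show "(`) h \<in> hom (H Mod center H) (K Mod center K)"
    proof (rule homI)
      fix C assume "C \<in> carrier (H Mod center H)"
      then obtain x where "x \<in> carrier H" "C = center H #>\<^bsub>H\<^esub> x"
        by (auto simp: FactGroup_def RCOSETS_def)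
      then show "h ` C \<in> carrier (K Mod center K)"
        using coset[of x] h.hom_closed[of x] by (auto simp: FactGroup_def RCOSETS_def)
    next
      fix C D assume "C \<in> carrier (H Mod center H)" "D \<in> carrier (H Mod center H)"
      then have "C \<subseteq> carrier H" "D \<subseteq> carrier H" using carr by auto
      then show "h ` (C \<otimes>\<^bsub>H Mod center H\<^esub> D) = h ` C \<otimes>\<^bsub>K Mod center K\<^esub> h ` D"
        using set_mult_hom[OF hom] by (simp add: FactGroup_def)
    qed
    have "inj_on ((`) h) (carrier (H Mod center H))"
      using carr inj by (intro inj_onI) (simp add: inj_on_image_eq_iff)
    moreover have "(`) h ` carrier (H Mod center H) = carrier (K Mod center K)"
    proof -
      have "carrier (H Mod center H) = (\<lambda>x. center H #>\<^bsub>H\<^esub> x) ` carrier H"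
        by (auto simp: FactGroup_def RCOSETS_def)
      then have "(`) h ` carrier (H Mod center H) = (\<lambda>x. center K #>\<^bsub>K\<^esub> h x) ` carrier H"
        using coset by (simp add: image_image)
      also have "\<dots> = (\<lambda>y. center K #>\<^bsub>K\<^esub> y) ` (h ` carrier H)"
        by (simp add: image_image)
      also have "\<dots> = carrier (K Mod center K)"
        unfolding surj by (auto simp: FactGroup_def RCOSETS_def)
      finally show ?thesis .
    qed
    ultimately show "bij_betw ((`) h) (carrier (H Mod center H)) (carrier (K Mod center K))"
      by (simp add: bij_betw_def)
  qed
  have derived: "h ` derived H (carrier H) = derived K (carrier K)"
    using h.derived_img[of "carrier H"] surj by simp
  have dsub: "derived H (carrier H) \<subseteq> carrier H" by (simp add: H.derived_in_carrier)
  have \<chi>: "h \<in> iso (H\<lparr>carrier := derived H (carrier H)\<rparr>) (K\<lparr>carrier := derived K (carrier K)\<rparr>)"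
  proof (rule isoI)
    show "h \<in> hom (H\<lparr>carrier := derived H (carrier H)\<rparr>) (K\<lparr>carrier := derived K (carrier K)\<rparr>)"
      using derived dsub by (intro homI) (auto simp: subset_iff)
    show "bij_betw h (carrier (H\<lparr>carrier := derived H (carrier H)\<rparr>))
        (carrier (K\<lparr>carrier := derived K (carrier K)\<rparr>))"
      using derived inj_on_subset[OF inj dsub] by (simp add: bij_betw_def)
  qed
  have comm: "h (commutator H x y) = commutator K (h x) (h y)"
    if "x \<in> carrier H" "y \<in> carrier H" for x y
    using that by (simp add: commutator_def)
  obtain \<theta> \<phi> where \<theta>: "\<theta> \<in> iso (G Mod center G) (H Mod center H)"
    and \<phi>: "\<phi> \<in> iso (G\<lparr>carrier := derived G (carrier G)\<rparr>) (H\<lparr>carrier := derived H (carrier H)\<rparr>)"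
    and compat: "\<And>g\<^sub>1 g\<^sub>2 h\<^sub>1 h\<^sub>2. \<lbrakk>g\<^sub>1 \<in> carrier G; g\<^sub>2 \<in> carrier G; h\<^sub>1 \<in> carrier H; h\<^sub>2 \<in> carrier H;
        \<theta> (center G #>\<^bsub>G\<^esub> g\<^sub>1) = center H #>\<^bsub>H\<^esub> h\<^sub>1; \<theta> (center G #>\<^bsub>G\<^esub> g\<^sub>2) = center H #>\<^bsub>H\<^esub> h\<^sub>2\<rbrakk>
        \<Longrightarrow> \<phi> (commutator G g\<^sub>1 g\<^sub>2) = commutator H h\<^sub>1 h\<^sub>2"
    using GH unfolding isoclinic_def by blast
  have pull: "\<exists>v\<in>carrier H. h v = k \<and> \<theta> (center G #>\<^bsub>G\<^esub> g) = center H #>\<^bsub>H\<^esub> v"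
    if g: "g \<in> carrier G" and k: "k \<in> carrier K"
      and eq: "h ` \<theta> (center G #>\<^bsub>G\<^esub> g) = center K #>\<^bsub>K\<^esub> k" for g k
  proof -
    obtain v where v: "v \<in> carrier H" "h v = k" using k unfolding surj[symmetric] by blast
    have "center G #>\<^bsub>G\<^esub> g \<in> carrier (G Mod center G)"
      using g by (auto simp: FactGroup_def RCOSETS_def)
    then have "\<theta> (center G #>\<^bsub>G\<^esub> g) \<in> carrier (H Mod center H)"
      using \<theta> by (auto simp: iso_def bij_betw_def)
    moreover have "center H #>\<^bsub>H\<^esub> v \<in> carrier (H Mod center H)"
      using v by (auto simp: FactGroup_def RCOSETS_def)
    moreover have "h ` \<theta> (center G #>\<^bsub>G\<^esub> g) = h ` (center H #>\<^bsub>H\<^esub> v)"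
      using eq v coset by simp
    ultimately have "\<theta> (center G #>\<^bsub>G\<^esub> g) = center H #>\<^bsub>H\<^esub> v"
      using inj_on_image_eq_iff[OF inj carr carr] by simp
    with v show ?thesis by blast
  qed
  show ?thesis
    unfolding isoclinic_def
  proof (intro exI conjI ballI impI)
    show "(`) h \<circ> \<theta> \<in> iso (G Mod center G) (K Mod center K)"
      by (rule iso_set_trans[OF \<theta> \<psi>])
    show "h \<circ> \<phi> \<in> iso (G\<lparr>carrier := derived G (carrier G)\<rparr>) (K\<lparr>carrier := derived K (carrier K)\<rparr>)"
      by (rule iso_set_trans[OF \<phi> \<chi>])
    fix g\<^sub>1 g\<^sub>2 k\<^sub>1 k\<^sub>2
    assume g: "g\<^sub>1 \<in> carrier G" "g\<^sub>2 \<in> carrier G" and k: "k\<^sub>1 \<in> carrier K" "k\<^sub>2 \<in> carrier K"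
      and eq: "((`) h \<circ> \<theta>) (center G #>\<^bsub>G\<^esub> g\<^sub>1) = center K #>\<^bsub>K\<^esub> k\<^sub>1 \<and>
               ((`) h \<circ> \<theta>) (center G #>\<^bsub>G\<^esub> g\<^sub>2) = center K #>\<^bsub>K\<^esub> k\<^sub>2"
    obtain v\<^sub>1 where v1: "v\<^sub>1 \<in> carrier H" "h v\<^sub>1 = k\<^sub>1" "\<theta> (center G #>\<^bsub>G\<^esub> g\<^sub>1) = center H #>\<^bsub>H\<^esub> v\<^sub>1"
      using pull[OF g(1) k(1)] eq by auto
    obtain v\<^sub>2 where v2: "v\<^sub>2 \<in> carrier H" "h v\<^sub>2 = k\<^sub>2" "\<theta> (center G #>\<^bsub>G\<^esub> g\<^sub>2) = center H #>\<^bsub>H\<^esub> v\<^sub>2"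
      using pull[OF g(2) k(2)] eq by auto
    have "\<phi> (commutator G g\<^sub>1 g\<^sub>2) = commutator H v\<^sub>1 v\<^sub>2"
      using compat g v1 v2 by blast
    then show "(h \<circ> \<phi>) (commutator G g\<^sub>1 g\<^sub>2) = commutator K k\<^sub>1 k\<^sub>2"
      using comm v1 v2 by simp
  qed
qed

lemma (in group) isoclinic_refl: "isoclinic G G"
proof -
  interpret Z: normal "center G" G by (rule center_normal)
  have eq: "commutator G g\<^sub>1 g\<^sub>2 = commutator G h\<^sub>1 h\<^sub>2"
    if g: "g\<^sub>1 \<in> carrier G" "g\<^sub>2 \<in> carrier G" and h: "h\<^sub>1 \<in> carrier G" "h\<^sub>2 \<in> carrier G"
      and eqs: "center G #> g\<^sub>1 = center G #> h\<^sub>1" "center G #> g\<^sub>2 = center G #> h\<^sub>2" for g\<^sub>1 g\<^sub>2 h\<^sub>1 h\<^sub>2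
  proof -
    obtain z where z: "z \<in> center G" "g\<^sub>1 = z \<otimes> h\<^sub>1"
      using rcos_self[OF g(1) Z.subgroup_axioms, unfolded eqs(1)] by (auto simp: r_coset_def)
    obtain w where w: "w \<in> center G" "g\<^sub>2 = w \<otimes> h\<^sub>2"
      using rcos_self[OF g(2) Z.subgroup_axioms, unfolded eqs(2)] by (auto simp: r_coset_def)
    have zc: "z \<in> carrier G" "\<And>x. x \<in> carrier G \<Longrightarrow> x \<otimes> z = z \<otimes> x"
      using center_closed[OF z(1)] center_comm[OF z(1)] by simp_all
    have wc: "w \<in> carrier G" "\<And>x. x \<in> carrier G \<Longrightarrow> x \<otimes> w = w \<otimes> x"
      using center_closed[OF w(1)] center_comm[OF w(1)] by simp_all
    have conj: "c \<otimes> x \<otimes> inv c = x"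
      if "c \<in> carrier G" "x \<in> carrier G" "x \<otimes> c = c \<otimes> x" for c x
    proof -
      have "c \<otimes> x \<otimes> inv c = x \<otimes> c \<otimes> inv c" by (simp only: that(3))
      then show ?thesis using that(1,2) by (simp add: m_assoc)
    qed
    have left: "commutator G (z \<otimes> x) y = commutator G x y"
      if x: "x \<in> carrier G" and y: "y \<in> carrier G" for x y
    proof -
      have "commutator G (z \<otimes> x) y = z \<otimes> (x \<otimes> y \<otimes> inv x) \<otimes> inv z \<otimes> inv y"
        using x y zc(1) by (simp add: commutator_def inv_mult_group m_assoc)
      also have "z \<otimes> (x \<otimes> y \<otimes> inv x) \<otimes> inv z = x \<otimes> y \<otimes> inv x"
        by (rule conj) (use x y zc(1) zc(2)[of "x \<otimes> y \<otimes> inv x"] in simp_all)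
      finally show ?thesis by (simp add: commutator_def)
    qed
    have right: "commutator G x (w \<otimes> y) = commutator G x y"
      if x: "x \<in> carrier G" and y: "y \<in> carrier G" for x y
    proof -
      have "commutator G x (w \<otimes> y) = (x \<otimes> w) \<otimes> (y \<otimes> inv x \<otimes> inv y) \<otimes> inv w"
        using x y wc(1) by (simp add: commutator_def inv_mult_group m_assoc)
      also have "x \<otimes> w = w \<otimes> x" by (rule wc(2)[OF x])
      also have "w \<otimes> x \<otimes> (y \<otimes> inv x \<otimes> inv y) \<otimes> inv w
          = w \<otimes> (x \<otimes> y \<otimes> inv x \<otimes> inv y) \<otimes> inv w"
        using x y wc(1) by (simp add: m_assoc)
      also have "\<dots> = x \<otimes> y \<otimes> inv x \<otimes> inv y"
        by (rule conj) (use x y wc(1) wc(2)[of "x \<otimes> y \<otimes> inv x \<otimes> inv y"] in simp_all)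
      finally show ?thesis by (simp add: commutator_def)
    qed
    show ?thesis using h z w zc(1) wc(1) by (simp add: left right)
  qed
  show ?thesis
    unfolding isoclinic_def
  proof (intro exI[of _ "\<lambda>x. x"] conjI ballI impI iso_set_refl)
  qed (rule eq; blast)
qed

lemma isoclinic_nat_copy:
  assumes "group H" and "finite (carrier H)" and "isoclinic G H"
  shows "\<exists>K :: nat monoid. group K \<and> order K = order H \<and> isoclinic G K"
proof -
  interpret H: group H by fact
  obtain f :: "_ \<Rightarrow> nat" where f: "inj_on f (carrier H)"
    using finite_imp_inj_to_nat_seg[OF assms(2)] by blast
  let ?K = "image_group f H"
  have iso: "f \<in> iso H ?K" by (rule inj_imp_image_group_iso[OF f])
  have grp: "group ?K" by (rule H.inj_imp_image_group_is_group[OF f])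
  have "order ?K = order H"
    using iso_same_card[OF is_isoI[OF iso]] by (simp add: order_def)
  with grp isoclinic_iso_trans[OF assms(1) grp iso assms(3)] show ?thesis
    by (intro exI[of _ ?K] conjI)
qed

lemma isoclinism_rank_le:
  assumes "group H" and "order H = 2 ^ r" and "isoclinic G H"
  shows "isoclinism_rank G \<le> r"
proof -
  have "finite (carrier H)"
    by (rule ccontr) (use assms(2) in \<open>simp add: order_def\<close>)
  from isoclinic_nat_copy[OF assms(1) this assms(3)]
  have "\<exists>K :: nat monoid. group K \<and> order K = 2 ^ r \<and> isoclinic G K"
    by (simp only: assms(2))
  then show ?thesis
    unfolding isoclinism_rank_def by (rule Least_le)
qed

lemma isoclinism_rank_attained:
  assumes "group G" and "order G = 2 ^ m"
  shows "\<exists>H :: nat monoid. group H \<and> order H = 2 ^ isoclinism_rank G \<and> isoclinic G H"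
proof -
  have "finite (carrier G)"
    by (rule ccontr) (use assms(2) in \<open>simp add: order_def\<close>)
  from isoclinic_nat_copy[OF assms(1) this group.isoclinic_refl[OF assms(1)]]
  have "\<exists>H :: nat monoid. group H \<and> order H = 2 ^ m \<and> isoclinic G H"
    by (simp only: assms(2))
  then show ?thesis
    unfolding isoclinism_rank_def by (rule LeastI)
qed

end

theory Submission
  imports Defs
begin

text \<open>
  A group \<open>G\<close> satisfies the hypothesis only if its center \<open>Z\<close> has index 4: the index is that of the
  center of a group \<open>H\<close> of order 8, so it divides 8; it is not 1, since then \<open>G\<close> would be isoclinic
  to the trivial group, not 2, since no center has prime index, and not 8, since 2-groups have
  nontrivial center. When the index is 4, every centralizer of a noncentral element is abelian of
  index 2. By the Burnside lemma, \<open>|G|\<close> times \<open>alpha G n\<close> is the sum of the \<open>n\<close>-th powers of the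
  centralizer orders of all elements, and \<open>|G|\<close> times \<open>beta G n\<close> is the number of commuting
  \<open>(n+1)\<close>-tuples, which obeys a linear recursion on splitting off the first entry.
\<close>

text \<open>The geometric series composed with \<open>b * X\<close>. It turns the right-hand sides
  of the theorem into explicit coefficient sequences.\<close>

lemma fps_geometric:
  fixes a b :: "'a :: field"
  shows "fps_const a / (1 - fps_const b * fps_X) = Abs_fps (\<lambda>n. a * b ^ n)"
proof -
  have "fps_const a / (1 - fps_const b * fps_X) = fps_const a * (1 / (1 - fps_const b * fps_X))"
    by (simp add: fps_divide_unit)
  also have "1 / (1 - fps_const b * fps_X) = Abs_fps (\<lambda>n. b ^ n)"
    by (subst gp[symmetric]) (simp_all add: fps_compose_linear)
  finally show ?thesis by (simp add: fps_eq_iff)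
qed

section \<open>Commuting tuples and centralizers\<close>

definition centralizer :: "('a, 'b) monoid_scheme \<Rightarrow> 'a \<Rightarrow> 'a set" where
  "centralizer G x = {g \<in> carrier G. g \<otimes>\<^bsub>G\<^esub> x = x \<otimes>\<^bsub>G\<^esub> g}"

text \<open>The tail must commute internally and with the head. The form as an injective image of a
  dependent sum lets the cardinality be computed by summing over the head.\<close>

lemma commuting_tuples_Suc:
  "commuting_tuples G (Suc n) =
     (\<lambda>(g, xs). g # xs) `
       (SIGMA g : carrier G. {xs \<in> commuting_tuples G n. set xs \<subseteq> centralizer G g})"
  (is "?L = ?R")
proof
  show "?L \<subseteq> ?R"
  proof
    fix ys assume ys: "ys \<in> ?L"
    then obtain g xs where "ys = g # xs" "length xs = n"
      by (auto simp: commuting_tuples_def tuples_def length_Suc_conv)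
    then show "ys \<in> ?R"
      using ys by (intro image_eqI[of _ _ "(g, xs)"])
        (auto simp: commuting_tuples_def tuples_def centralizer_def)
  qed
  show "?R \<subseteq> ?L"
    by (auto simp: commuting_tuples_def tuples_def centralizer_def subset_iff)
qed

lemma finite_tuples: "finite (carrier G) \<Longrightarrow> finite (tuples G n)"
  using finite_lists_length_eq[of "carrier G" n] unfolding tuples_def by (simp add: conj_commute)

lemma finite_commuting_tuples: "finite (carrier G) \<Longrightarrow> finite (commuting_tuples G n)"
  using finite_tuples[of G n] unfolding commuting_tuples_def by simp

lemma card_commuting_tuples_Suc:
  assumes "finite (carrier G)"
  shows "card (commuting_tuples G (Suc n)) =
    (\<Sum>g\<in>carrier G. card {xs \<in> commuting_tuples G n. set xs \<subseteq> centralizer G g})"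
  unfolding commuting_tuples_Suc
  by (subst card_image) (auto simp: inj_on_def assms finite_commuting_tuples)

section \<open>Orbit counts by the Burnside lemma\<close>

context group
begin

lemma conj_eq_iff:
  assumes "g \<in> carrier G" "x \<in> carrier G"
  shows "g \<otimes> x \<otimes> inv g = x \<longleftrightarrow> x \<in> centralizer G g"
proof -
  have "g \<otimes> x \<otimes> inv g = x \<longleftrightarrow> g \<otimes> x = x \<otimes> g"
    using assms inv_solve_right'[of x "g \<otimes> x" g] by simp
  then show ?thesis using assms by (simp add: centralizer_def eq_commute)
qed

text \<open>Conjugation acts entrywise, so a tuple is fixed when each entry is. Leaving
  \<open>E\<close> general serves both actions.\<close>

lemma conj_action_invariants:
  assumes "E \<subseteq> lists (carrier G)" "g \<in> carrier G"
  shows "invariants E (conj_action G E) g = {xs \<in> E. set xs \<subseteq> centralizer G g}"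
proof -
  have "map (\<lambda>x. g \<otimes> x \<otimes> inv g) xs = xs \<longleftrightarrow> set xs \<subseteq> centralizer G g" if "xs \<in> E" for xs
  proof -
    have "map (\<lambda>x. g \<otimes> x \<otimes> inv g) xs = xs \<longleftrightarrow> (\<forall>x\<in>set xs. g \<otimes> x \<otimes> inv g = x)"
      using map_eq_conv[of "\<lambda>x. g \<otimes> x \<otimes> inv g" xs "\<lambda>x. x"] by simp
    also have "\<dots> \<longleftrightarrow> (\<forall>x\<in>set xs. x \<in> centralizer G g)"
      using assms that by (intro ball_cong refl conj_eq_iff) auto
    finally show ?thesis by blast
  qed
  then show ?thesis by (auto simp: invariants_def conj_action_def)
qed

text \<open>The tuples fixed by \<open>g\<close> are arbitrary lists over its centralizer, whence
  the \<open>n\<close>-th power.\<close>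

lemma alpha_burnside:
  assumes "finite (carrier G)"
  shows "alpha G n * order G = (\<Sum>g\<in>carrier G. card (centralizer G g) ^ n)"
proof -
  interpret group_action G "tuples G n" "conj_action G (tuples G n)"
    by (rule conj_action_tuples)
  have "alpha G n * order G =
      (\<Sum>g\<in>carrier G. card (invariants (tuples G n) (conj_action G (tuples G n)) g))"
    unfolding alpha_def by (rule burnside[OF assms finite_tuples[OF assms]])
  also have "\<dots> = (\<Sum>g\<in>carrier G. card (centralizer G g) ^ n)"
  proof (rule sum.cong)
    fix g assume g: "g \<in> carrier G"
    have "{xs \<in> tuples G n. set xs \<subseteq> centralizer G g} =
        {xs. set xs \<subseteq> centralizer G g \<and> length xs = n}"
      by (auto simp: tuples_def centralizer_def)
    moreover have "finite (centralizer G g)"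
      using assms by (simp add: centralizer_def)
    ultimately show "card (invariants (tuples G n) (conj_action G (tuples G n)) g) =
        card (centralizer G g) ^ n"
      using g by (subst conj_action_invariants) (auto simp: tuples_def card_lists_length_eq)
  qed simp
  finally show ?thesis .
qed

text \<open>Prepending \<open>g\<close> to a commuting tuple fixed by \<open>g\<close> gives a
  commuting tuple one entry longer, and every such longer tuple arises once. The Burnside sum is
  therefore the sum obtained by splitting off a head.\<close>

lemma beta_burnside:
  assumes "finite (carrier G)"
  shows "beta G n * order G = card (commuting_tuples G (Suc n))"
proof -
  interpret group_action G "commuting_tuples G n" "conj_action G (commuting_tuples G n)"
    by (rule conj_action_commuting_tuples)
  have "commuting_tuples G n \<subseteq> lists (carrier G)"
    by (auto simp: commuting_tuples_def tuples_def)
  then show ?thesis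
    unfolding beta_def card_commuting_tuples_Suc[OF assms]
    by (simp add: burnside assms finite_commuting_tuples conj_action_invariants)
qed

section \<open>Subgroups between the center and the group\<close>

lemma centralizer_subgroup:
  assumes x: "x \<in> carrier G"
  shows "subgroup (centralizer G x) G"
proof (rule subgroupI)
  show "centralizer G x \<noteq> {}"
    using x by (auto simp: centralizer_def intro!: exI[of _ \<one>])
next
  fix a assume a: "a \<in> centralizer G x"
  then have ac: "a \<in> carrier G" and "a \<otimes> x = x \<otimes> a" by (simp_all add: centralizer_def)
  then have "inv a \<otimes> (a \<otimes> x) \<otimes> inv a = inv a \<otimes> (x \<otimes> a) \<otimes> inv a" by simp
  moreover have "inv a \<otimes> (a \<otimes> x) \<otimes> inv a = x \<otimes> inv a"
    using x ac by (simp flip: m_assoc)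
  moreover have "inv a \<otimes> (x \<otimes> a) \<otimes> inv a = inv a \<otimes> x"
    using x ac by (simp add: m_assoc)
  ultimately show "inv a \<in> centralizer G x" using ac by (simp add: centralizer_def)
next
  fix a b assume ab: "a \<in> centralizer G x" "b \<in> centralizer G x"
  then have c: "a \<in> carrier G" "b \<in> carrier G" by (simp_all add: centralizer_def)
  have "a \<otimes> b \<otimes> x = a \<otimes> (x \<otimes> b)" using ab x c by (simp add: centralizer_def m_assoc)
  also have "\<dots> = x \<otimes> a \<otimes> b" using ab x c by (simp add: centralizer_def flip: m_assoc)
  also have "\<dots> = x \<otimes> (a \<otimes> b)" using x c by (simp add: m_assoc)
  finally show "a \<otimes> b \<in> centralizer G x" using c by (simp add: centralizer_def)
qed (auto simp: centralizer_def)

lemma center_subset_centralizer: "x \<in> carrier G \<Longrightarrow> center G \<subseteq> centralizer G x"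
  by (auto simp: center_def centralizer_def)

lemma center_subgroup: "subgroup (center G) G"
  using center_normal by (rule normal_imp_subgroup)

lemma centralizer_center: "z \<in> center G \<Longrightarrow> centralizer G z = carrier G"
  by (auto simp: center_def centralizer_def)

text \<open>The first inclusion is strict because of \<open>x\<close> itself, the second because of
  any element not commuting with \<open>x\<close>.\<close>

lemma centralizer_noncentral:
  assumes "x \<in> carrier G" "x \<notin> center G"
  shows "center G \<subset> centralizer G x" "centralizer G x \<subset> carrier G"
proof -
  have "x \<in> centralizer G x" using assms by (simp add: centralizer_def)
  then show "center G \<subset> centralizer G x"
    using center_subset_centralizer assms by blast
  show "centralizer G x \<subset> carrier G"
  proof
    show "centralizer G x \<subseteq> carrier G" by (auto simp: centralizer_def)
    obtain g where "g \<in> carrier G" "x \<otimes> g \<noteq> g \<otimes> x"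
      using assms by (auto simp: center_def)
    then show "centralizer G x \<noteq> carrier G" by (force simp: centralizer_def)
  qed
qed

text \<open>Lagrange's theorem inside \<open>L\<close>. The quotient form allows the indices along a
  chain of subgroups to be multiplied.\<close>

lemma proper_subgroup_card:
  assumes fin: "finite (carrier G)" and K: "subgroup K G" and L: "subgroup L G" and KL: "K \<subset> L"
  obtains q where "q \<ge> 2" "card L = q * card K"
proof -
  interpret L: group "G\<lparr>carrier := L\<rparr>" using L by (rule subgroup_imp_group)
  have "subgroup K (G\<lparr>carrier := L\<rparr>)" using K L KL by (intro subgroup_incl) auto
  from L.lagrange[OF this]
  have q: "card L = card (rcosets\<^bsub>G\<lparr>carrier := L\<rparr>\<^esub> K) * card K" (is "_ = ?q * _")
    by (simp add: order_def)
  have "finite L" using fin L finite_subset subgroup.subset by blast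
  then have "card K < card L" using KL by (rule psubset_card_mono)
  with q have "?q \<noteq> 0" "?q \<noteq> 1" by auto
  then have "?q \<ge> 2" by linarith
  then show thesis using q by (rule that)
qed

text \<open>A noncentral \<open>x\<close> puts its centralizer strictly between the center and the
  group; two proper steps make the index at least 4.\<close>

lemma center_index_neq_2:
  assumes fin: "finite (carrier G)"
  shows "order G \<noteq> 2 * card (center G)"
proof
  assume eq: "order G = 2 * card (center G)"
  have pos: "order G > 0" using fin by (simp add: order_gt_0_iff_finite)
  then have "order G \<noteq> card (center G)" using eq by linarith
  then have "center G \<noteq> carrier G" unfolding order_def by metis
  then obtain x where x: "x \<in> carrier G" "x \<notin> center G" using center_subset[of G] by blast
  note C = centralizer_noncentral[OF x] centralizer_subgroup[OF x(1)]
  obtain q where q: "q \<ge> 2" "card (centralizer G x) = q * card (center G)"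
    using proper_subgroup_card[OF fin center_subgroup C(3) C(1)] .
  obtain r where r: "r \<ge> 2" "order G = r * card (centralizer G x)"
    using proper_subgroup_card[OF fin C(3) subgroup_self C(2)] unfolding order_def .
  have "order G \<ge> 2 * (2 * card (center G))"
    unfolding r(2) q(2) by (intro mult_le_mono q r le_refl)
  then show False using eq pos by simp
qed

section \<open>Groups whose center has index 4\<close>

lemma
  assumes fin: "finite (carrier G)" and idx: "order G = 4 * card (center G)"
    and x: "x \<in> carrier G" "x \<notin> center G"
  shows card_centralizer_index_4: "card (centralizer G x) = 2 * card (center G)"
    and centralizer_abelian_index_4:
      "\<And>y z. y \<in> centralizer G x \<Longrightarrow> z \<in> centralizer G x \<Longrightarrow> y \<otimes> z = z \<otimes> y"
proof -
  have pos: "card (center G) > 0"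
    using idx fin order_gt_0_iff_finite by simp
  note C = centralizer_noncentral[OF x] centralizer_subgroup[OF x(1)]
  obtain q where q: "q \<ge> 2" "card (centralizer G x) = q * card (center G)"
    using proper_subgroup_card[OF fin center_subgroup C(3) C(1)] .
  obtain r where r: "r \<ge> 2" "order G = r * card (centralizer G x)"
    using proper_subgroup_card[OF fin C(3) subgroup_self C(2)] unfolding order_def .
  \<comment> \<open>Both steps of the chain from the center through the centralizer to the group
    have index at least 2, so each is exactly 2.\<close>
  have "r * q = 4" using idx r q pos by simp
  then have "2 * q \<le> 4" using r(1) by (metis mult_le_mono1)
  then show card: "card (centralizer G x) = 2 * card (center G)" using q by simp
  have finC: "finite (centralizer G x)" using fin by (simp add: centralizer_def)
  show "y \<otimes> z = z \<otimes> y" if y: "y \<in> centralizer G x" and z: "z \<in> centralizer G x" for y z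
  proof -
    have yc: "y \<in> carrier G" using y by (simp add: centralizer_def)
    let ?K = "centralizer G x \<inter> centralizer G y"
    have K: "subgroup ?K G"
      using x yc by (intro subgroups_Inter_pair centralizer_subgroup)
    \<comment> \<open>As \<open>x\<close> is noncentral, \<open>?K\<close> properly contains the
      center. There is no room for that below the centralizer of \<open>x\<close>, so the two
      coincide and \<open>z\<close> commutes with \<open>y\<close>.\<close>
    have "x \<in> ?K" using x y by (simp add: centralizer_def)
    then have "center G \<subset> ?K"
      using center_subset_centralizer x yc by blast
    then obtain s where s: "s \<ge> 2" "card ?K = s * card (center G)"
      using proper_subgroup_card[OF fin center_subgroup K] by blast
    then have "card (centralizer G x) \<le> card ?K" using card by simp
    then have "?K = centralizer G x" using finC by (intro card_seteq) auto
    then have "z \<in> centralizer G y" using z by blast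
    then show ?thesis by (simp add: centralizer_def)
  qed
qed

text \<open>Both counts below sum a quantity that depends only on whether the element is central,
  and a quarter of the elements are.\<close>

lemma sum_carrier_center_index_4:
  fixes f :: "'a \<Rightarrow> nat"
  assumes fin: "finite (carrier G)" and idx: "order G = 4 * card (center G)"
    and "\<And>g. g \<in> center G \<Longrightarrow> f g = a" "\<And>g. g \<in> carrier G \<Longrightarrow> g \<notin> center G \<Longrightarrow> f g = b"
  shows "sum f (carrier G) = card (center G) * a + 3 * card (center G) * b"
proof -
  have "finite (center G)" using fin center_subset by (rule rev_finite_subset)
  then have "card (carrier G - center G) = 3 * card (center G)"
    using idx center_subset[of G] by (subst card_Diff_subset) (auto simp: order_def)
  moreover have "sum f (carrier G) = sum f (carrier G - center G) + sum f (center G)"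
    using center_subset fin by (rule sum.subset_diff)
  ultimately show ?thesis using assms(3,4) by simp
qed

lemma alpha_index_4:
  assumes fin: "finite (carrier G)" and idx: "order G = 4 * card (center G)"
  shows "4 * alpha G n = (4 * card (center G)) ^ n + 3 * (2 * card (center G)) ^ n"
proof -
  have pos: "card (center G) > 0"
    using idx fin order_gt_0_iff_finite by simp
  have "alpha G n * order G =
      card (center G) * (4 * card (center G)) ^ n + 3 * card (center G) * (2 * card (center G)) ^ n"
    unfolding alpha_burnside[OF fin]
    by (rule sum_carrier_center_index_4[OF fin idx])
      (simp_all add: centralizer_center card_centralizer_index_4[OF fin idx] idx flip: order_def)
  \<comment> \<open>The order is \<open>4 * card (center G)\<close>, so the positive factor
    \<open>card (center G)\<close> is common to both sides and cancels.\<close>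
  then have "card (center G) * (4 * alpha G n) =
      card (center G) * ((4 * card (center G)) ^ n + 3 * (2 * card (center G)) ^ n)"
    unfolding idx by (simp only: algebra_simps)
  then show ?thesis using pos by simp
qed

text \<open>With \<open>z = card (center G)\<close>, the counts satisfy
  \<open>c (n + 1) = z * c n + 3 * z * (2 * z) ^ n\<close> and \<open>c 0 = 1\<close>. The negative
  term of the solution is moved to the left to avoid subtraction on naturals.\<close>

lemma card_commuting_tuples_index_4:
  assumes fin: "finite (carrier G)" and idx: "order G = 4 * card (center G)"
  shows "card (commuting_tuples G n) + 2 * card (center G) ^ n = 3 * (2 * card (center G)) ^ n"
proof (induction n)
  case 0
  have "commuting_tuples G 0 = {[]}"
    by (auto simp: commuting_tuples_def tuples_def)
  then show ?case by simp
next
  case (Suc n)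
  have "card (commuting_tuples G (Suc n)) =
      card (center G) * card (commuting_tuples G n)
        + 3 * card (center G) * (2 * card (center G)) ^ n"
    unfolding card_commuting_tuples_Suc[OF fin]
  proof (rule sum_carrier_center_index_4[OF fin idx])
    fix g assume "g \<in> center G"
    then have "{xs \<in> commuting_tuples G n. set xs \<subseteq> centralizer G g} = commuting_tuples G n"
      by (auto simp: centralizer_center commuting_tuples_def tuples_def)
    then show "card {xs \<in> commuting_tuples G n. set xs \<subseteq> centralizer G g} =
        card (commuting_tuples G n)" by simp
  next
    fix g assume g: "g \<in> carrier G" "g \<notin> center G"
    have "centralizer G g \<subseteq> carrier G" by (auto simp: centralizer_def)
    \<comment> \<open>After a noncentral head any tail over its centralizer is allowed, since that
      centralizer is abelian.\<close>
    then have "{xs \<in> commuting_tuples G n. set xs \<subseteq> centralizer G g} =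
        {xs. set xs \<subseteq> centralizer G g \<and> length xs = n}"
      using centralizer_abelian_index_4[OF fin idx g]
      by (auto simp: commuting_tuples_def tuples_def subset_iff)
    moreover have "finite (centralizer G g)"
      using fin by (simp add: centralizer_def)
    ultimately show "card {xs \<in> commuting_tuples G n. set xs \<subseteq> centralizer G g} =
        (2 * card (center G)) ^ n"
      by (simp add: card_lists_length_eq card_centralizer_index_4[OF fin idx g])
  qed
  moreover have "card (center G) * (card (commuting_tuples G n) + 2 * card (center G) ^ n) =
      card (center G) * (3 * (2 * card (center G)) ^ n)"
    by (simp only: Suc.IH)
  ultimately show ?case by (simp add: algebra_simps)
qed

section \<open>Determining the index of the center from the rank\<close>

lemma isoclinism_rank_abelian:
  assumes Z: "center G = carrier G"
  shows "isoclinism_rank G = 0"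
proof -
  let ?H = "G\<lparr>carrier := {\<one>}\<rparr>"
  have H: "group ?H" using triv_subgroup by (rule subgroup_imp_group)
  interpret H: group ?H by (rule H)
  have comm: "x \<otimes> y \<otimes> inv x \<otimes> inv y = \<one>" if "x \<in> carrier G" "y \<in> carrier G" for x y
  proof -
    have "x \<otimes> y \<otimes> inv x \<otimes> inv y = y \<otimes> x \<otimes> inv x \<otimes> inv y"
      using center_comm[of x G y] that Z by simp
    also have "\<dots> = \<one>" using that by (simp add: m_assoc)
    finally show ?thesis .
  qed
  have "derived_set G (carrier G) = {\<one>}"
    using comm by auto
  then have dG: "derived G (carrier G) = {\<one>}"
    unfolding derived_def by (simp add: generate_one)
  have invH: "inv\<^bsub>?H\<^esub> \<one> = \<one>" using H.inv_one by simp
  have dH: "derived ?H (carrier ?H) = {\<one>}"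
    using H.derived_in_carrier[of "carrier ?H"] H.derived_is_subgroup[of "carrier ?H"]
      subgroup.one_closed by fastforce
  have ZH: "center ?H = {\<one>}" by (auto simp: center_def)
  have coset: "carrier G #> x = carrier G" if "x \<in> carrier G" for x
    using that by (simp add: coset_join2 subgroup_self)
  have qG: "carrier (G Mod center G) = {carrier G}"
    using coset by (auto simp: FactGroup_def RCOSETS_def Z)
  have qH: "carrier (?H Mod center ?H) = {{\<one>}}"
    by (auto simp: FactGroup_def RCOSETS_def ZH r_coset_def)
  \<comment> \<open>Both central quotients and both derived subgroups are trivial. The constant map
    and the identity serve as isomorphisms, and the order of \<open>?H\<close> is
    \<open>2 ^ 0\<close>.\<close>
  have "isoclinic G ?H"
    unfolding isoclinic_def
  proof (intro exI conjI ballI impI)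
    show "(\<lambda>_. {\<one>}) \<in> iso (G Mod center G) (?H Mod center ?H)"
    proof (rule isoI)
      show "(\<lambda>_. {\<one>}) \<in> hom (G Mod center G) (?H Mod center ?H)"
        by (rule homI) (simp_all add: qH, simp add: FactGroup_def set_mult_def)
    qed (simp add: qG qH bij_betw_def)
    show "(\<lambda>x. x) \<in> iso (G\<lparr>carrier := derived G (carrier G)\<rparr>)
        (?H\<lparr>carrier := derived ?H (carrier ?H)\<rparr>)"
      unfolding dG dH by (simp add: iso_def hom_def bij_betw_def)
  next
    fix g1 g2 h1 h2
    assume "g1 \<in> carrier G" "g2 \<in> carrier G" "h1 \<in> carrier ?H" "h2 \<in> carrier ?H"
    then show "commutator G g1 g2 = commutator ?H h1 h2"
      using invH by (simp add: commutator_def comm)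
  qed
  from isoclinism_rank_le[OF H _ this, of 0] show ?thesis
    by (simp add: order_def)
qed

text \<open>If the center were trivial, all conjugacy classes but that of \<open>\<one>\<close> would have size divisible by \<open>p\<close>.\<close>

lemma p_group_center_nontrivial:
  assumes p: "Factorial_Ring.prime p" and ord: "order G = p ^ n" and n: "n > 0"
  shows "center G \<noteq> {\<one>}"
proof
  assume Z: "center G = {\<one>}"
  define \<phi> where "\<phi> = (\<lambda>g. \<lambda>h\<in>carrier G. g \<otimes> h \<otimes> inv g)"
  interpret group_action G "carrier G" \<phi>
    unfolding \<phi>_def by (rule action_by_conjugation)
  have fin: "finite (carrier G)"
    using ord p order_gt_0_iff_finite by (simp add: prime_gt_0_nat)
  have orb: "p dvd card (orbit G \<phi> x)" if x: "x \<in> carrier G" "x \<noteq> \<one>" for x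
  proof (rule ccontr)
    assume np: "\<not> p dvd card (orbit G \<phi> x)"
    have "card (orbit G \<phi> x) dvd p ^ n"
      using orbit_stabilizer_theorem[OF x(1)] ord by (metis dvd_triv_left)
    then obtain k where k: "card (orbit G \<phi> x) = p ^ k"
      using p by (auto simp: divides_primepow_nat)
    \<comment> \<open>A power of \<open>p\<close> not divisible by \<open>p\<close> has exponent 0.
      The class of \<open>x\<close> is then a singleton, which makes \<open>x\<close>
      central.\<close>
    with np have "card (orbit G \<phi> x) = 1" by (cases k) auto
    then obtain y where "orbit G \<phi> x = {y}" by (rule card_1_singletonE)
    with orbit_refl[OF x(1)] have single: "orbit G \<phi> x = {x}" by auto
    have "x \<in> center G"
    proof (rule centerI[OF x(1)])
      fix g assume g: "g \<in> carrier G"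
      then have "\<phi> g x \<in> orbit G \<phi> x" by (auto simp: orbit_def)
      then have "g \<otimes> x \<otimes> inv g = x" using single x by (simp add: \<phi>_def)
      then show "x \<otimes> g = g \<otimes> x" using conj_eq_iff[OF g x(1)] by (simp add: centralizer_def)
    qed
    then show False using Z x by simp
  qed
  have orb1: "orbit G \<phi> \<one> = {\<one>}"
    by (auto simp: orbit_def \<phi>_def intro!: exI[of _ \<one>])
  then have mem: "{\<one>} \<in> orbits G (carrier G) \<phi>" by (auto simp: orbits_def)
  have finO: "finite (orbits G (carrier G) \<phi>)"
    using fin by (simp add: orbits_def)
  have "p dvd (\<Sum>c\<in>orbits G (carrier G) \<phi> - {{\<one>}}. card c)"
    by (rule dvd_sum) (use orb orb1 in \<open>auto simp: orbits_def\<close>)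
  \<comment> \<open>The class equation, with the class of the identity split off as the summand
    1.\<close>
  moreover have "order G = 1 + (\<Sum>c\<in>orbits G (carrier G) \<phi> - {{\<one>}}. card c)"
  proof -
    have "order G = (\<Sum>c\<in>orbits G (carrier G) \<phi>. card c)"
      using disjoint_sum[OF fin, of "\<lambda>_. 1::nat"] by (simp add: order_def)
    then show ?thesis using sum.remove[OF finO mem, of card] by simp
  qed
  moreover have "p dvd order G" using ord n by simp
  ultimately have "p dvd 1" by (metis dvd_add_left_iff)
  then show False using p by (simp add: not_prime_unit)
qed

text \<open>Isoclinic groups have isomorphic central quotients, so the index can be examined in
  \<open>G\<close> or in \<open>H\<close>: the values 1 and 2 are excluded in \<open>G\<close>, the
  value 8 in \<open>H\<close>.\<close>

lemma rank_3_center_index: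
  assumes ord: "order G = 2 ^ m" and rank: "isoclinism_rank G = 3"
  shows "order G = 4 * card (center G)"
proof -
  obtain H :: "nat monoid" where H: "group H" "order H = 2 ^ 3" and iso: "isoclinic G H"
    using isoclinism_rank_attained[OF is_group ord] unfolding rank by blast
  interpret H: group H by (rule H)
  have fin: "finite (carrier G)"
    using ord order_gt_0_iff_finite by simp
  define q where "q = card (rcosets center G)"
  have G: "q * card (center G) = order G"
    unfolding q_def by (rule lagrange[OF center_subgroup])
  obtain \<theta> where "\<theta> \<in> iso (G Mod center G) (H Mod center H)"
    using iso unfolding isoclinic_def by blast
  then have "card (carrier (G Mod center G)) = card (carrier (H Mod center H))"
    using iso_same_card is_isoI by blast
  then have "q * card (center H) = 2 ^ 3"
    using H.lagrange[OF H.center_subgroup] by (simp add: q_def FactGroup_def H)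
  \<comment> \<open>A divisor of 8 is a power of 2, leaving the candidates 1, 2, 4 and 8.\<close>
  then obtain k where k: "k \<le> 3" "q = 2 ^ k"
    by (metis divides_primepow_nat dvd_triv_left two_is_prime_nat)
  have "q \<noteq> 1"
  proof
    assume "q = 1"
    then have "center G = carrier G"
      using G center_subset[of G] fin by (intro card_subset_eq) (auto simp: order_def)
    then show False using isoclinism_rank_abelian rank by simp
  qed
  moreover have "q \<noteq> 2" using G center_index_neq_2[OF fin] by auto
  moreover have "q \<noteq> 8"
  proof
    assume "q = 8"
    then have "card (center H) = 1" using \<open>q * card (center H) = 2 ^ 3\<close> by simp
    then have "center H = {\<one>\<^bsub>H\<^esub>}"
      using subgroup.one_closed[OF H.center_subgroup] by (metis card_1_singletonE singletonD)
    then show False using H.p_group_center_nontrivial[OF two_is_prime_nat H(2)] by simp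
  qed
  moreover have "k = 0 \<or> k = 1 \<or> k = 2 \<or> k = 3" using k(1) by linarith
  ultimately have "q = 4" using k(2) by auto
  then show ?thesis using G by simp
qed

end

section \<open>The two generating functions\<close>

theorem lemma5p12:
  fixes G :: "('a, 'b) monoid_scheme" and m :: nat
  assumes "group G" and "order G = 2 ^ m" and "isoclinism_rank G = 3"
  shows "A_series G oo (fps_const (1 / of_nat (order G)) * fps_X) =
           fps_const (1 - 1 / 2 ^ 2) / (1 - fps_const (1 / 2) * fps_X)
           + fps_const (1 / 2 ^ 2) / (1 - fps_X)
       \<and> B_series G oo (fps_const (1 / of_nat (order G)) * fps_X) =
           fps_const (- (1 / 2)) / (1 - fps_const (1 / 2 ^ 2) * fps_X)
           + fps_const (1 + 1 / 2) / (1 - fps_const (1 / 2) * fps_X)"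
proof -
  interpret group G by fact
  have fin: "finite (carrier G)"
    using assms(2) order_gt_0_iff_finite by simp
  have idx: "order G = 4 * card (center G)"
    using assms(2,3) by (rule rank_3_center_index)
  define z :: rat where "z = of_nat (card (center G))"
  have z: "z \<noteq> 0" and N: "of_nat (order G) = 4 * z"
    using idx fin order_gt_0_iff_finite by (auto simp: z_def)
  \<comment> \<open>Powers of 4 are rewritten through powers of 2, so that
    \<open>field_simps\<close> meets a single base.\<close>
  have four_power: "(4::rat) ^ n = 2 ^ n * 2 ^ n" "((2::rat) ^ 2) ^ n = 2 ^ n * 2 ^ n" for n
    by (simp_all flip: power_mult_distrib)
  have \<alpha>: "(1 / (4 * z)) ^ n * of_nat (alpha G n) = (1 - 1 / 2 ^ 2) * (1 / 2) ^ n + 1 / 2 ^ 2" for n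
  proof -
    have "4 * of_nat (alpha G n) = (4 * z) ^ n + 3 * (2 * z) ^ n"
      using arg_cong[OF alpha_index_4[OF fin idx, of n], of "of_nat :: nat \<Rightarrow> rat"]
      by (simp add: z_def)
    then have "of_nat (alpha G n) = ((4 * z) ^ n + 3 * (2 * z) ^ n) / 4" by simp
    then show ?thesis
      using z by (simp only: power_mult_distrib power_divide power_one four_power) (simp add: field_simps)
  qed
  have \<beta>: "(1 / (4 * z)) ^ n * of_nat (beta G n) =
      - (1 / 2) * (1 / 2 ^ 2) ^ n + (1 + 1 / 2) * (1 / 2) ^ n" for n
  proof -
    \<comment> \<open>The exponent is \<open>Suc n\<close> because orbits of \<open>n\<close>-tuples
      are counted by commuting \<open>(n+1)\<close>-tuples.\<close>
    have "beta G n * order G + 2 * card (center G) ^ Suc n = 3 * (2 * card (center G)) ^ Suc n"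
      unfolding beta_burnside[OF fin] by (rule card_commuting_tuples_index_4[OF fin idx])
    from arg_cong[OF this, of "of_nat :: nat \<Rightarrow> rat"]
    have "of_nat (beta G n) * (4 * z) + 2 * z ^ Suc n = 3 * (2 * z) ^ Suc n"
      by (simp add: N flip: z_def)
    \<comment> \<open>Pulling out one factor \<open>z\<close> brings the exponents back from
      \<open>Suc n\<close> to \<open>n\<close>.\<close>
    then have "z * (of_nat (beta G n) * 4 + 2 * z ^ n) = z * (6 * (2 * z) ^ n)"
      by (simp add: algebra_simps)
    then have "of_nat (beta G n) * 4 + 2 * z ^ n = 6 * (2 * z) ^ n"
      using z by simp
    then have "of_nat (beta G n) = (6 * (2 * z) ^ n - 2 * z ^ n) / 4" by simp
    then show ?thesis
      using z by (simp only: power_mult_distrib power_divide power_one four_power) (simp add: field_simps)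
  qed
  \<comment> \<open>The denominator \<open>1 - fps_X\<close> shows no ratio to match
    \<open>fps_geometric\<close>, so ratio 1 is treated separately.\<close>
  have one: "fps_const a / (1 - fps_X) = Abs_fps (\<lambda>n. a)" for a :: rat
    using fps_geometric[of a 1] by simp
  show ?thesis
    \<comment> \<open>The substitution multiplies the \<open>n\<close>-th coefficient by
      \<open>(1 / (4 * z)) ^ n\<close>, which leaves exactly \<alpha> and \<beta> to
      compare.\<close>
    unfolding fps_compose_linear fps_geometric one N A_series_def B_series_def
    by (intro conjI fps_ext) (simp_all only: fps_nth_Abs_fps fps_add_nth \<alpha> \<beta>)
qed

end
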